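(* There exists a connected cubic bipartite graph $G$ such that $\gamma(G)=6$ and $b(G)=5$. Consequently, $b(G)=5>\frac92=\frac32\Delta(G)$, so the assertion "every finite simple graph $H$ with at least one edge satisfies $b(H)\le \frac32\Delta(H)$" (Teschner's conjecture) is false.
   Context: All graphs are finite, simple, and undirected. A graph is cubic if every vertex has degree $3$. $\Delta(G)$ denotes the maximum degree of $G$. A set $D\subseteq V(G)$ is a dominating set of $G$ if every vertex of $V(G)\setminus D$ has a neighbor in $D$. The domination number $\gamma(G)$ is the minimum cardinality of a dominating set of $G$. For $F\subseteq E(G)$, $G-F$ denotes the graph with vertex set $V(G)$ and edge set $E(G)\setminus F$. For a graph $G$ with $E(G)\neq\varnothing$, the bondage number is $b(G)=\min\{|F|: F\subseteq E(G),\ \gamma(G-F)>\gamma(G)\}$. *)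

theory Defs
  imports Complex_Main
begin

text \<open>
  Finite simple undirected graphs: an edge is a two-element set of vertices, so a set
  \<open>F\<close> of undirected edges is deleted, and counted, as a plain subset of \<open>edges G\<close>.
\<close>

record 'a ugraph =
  verts :: "'a set"
  edges :: "'a set set"

definition simple_graph :: "'a ugraph \<Rightarrow> bool" where
  "simple_graph G \<longleftrightarrow> finite (verts G) \<and> (\<forall>e \<in> edges G. e \<subseteq> verts G \<and> card e = 2)"

definition neighbors :: "'a ugraph \<Rightarrow> 'a \<Rightarrow> 'a set" where
  "neighbors G v = {u. {v, u} \<in> edges G}"

definition degree :: "'a ugraph \<Rightarrow> 'a \<Rightarrow> nat" where
  "degree G v = card (neighbors G v)"

definition max_degree :: "'a ugraph \<Rightarrow> nat" where
  "max_degree G = Max (degree G ` verts G)"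

definition cubic :: "'a ugraph \<Rightarrow> bool" where
  "cubic G \<longleftrightarrow> (\<forall>v \<in> verts G. degree G v = 3)"

text \<open>The graph without vertices is not connected.\<close>

definition connected_graph :: "'a ugraph \<Rightarrow> bool" where
  "connected_graph G \<longleftrightarrow> verts G \<noteq> {} \<and>
     (\<forall>u \<in> verts G. \<forall>v \<in> verts G. (u, v) \<in> {(x, y). {x, y} \<in> edges G}\<^sup>*)"

definition bipartite :: "'a ugraph \<Rightarrow> bool" where
  "bipartite G \<longleftrightarrow> (\<exists>A B. A \<union> B = verts G \<and> A \<inter> B = {} \<and>
     (\<forall>e \<in> edges G. \<exists>a \<in> A. \<exists>b \<in> B. e = {a, b}))"

definition dominating_set :: "'a ugraph \<Rightarrow> 'a set \<Rightarrow> bool" where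
  "dominating_set G D \<longleftrightarrow> D \<subseteq> verts G \<and>
     (\<forall>v \<in> verts G - D. \<exists>u \<in> D. {v, u} \<in> edges G)"

definition domination_number :: "'a ugraph \<Rightarrow> nat" where
  "domination_number G = Min {card D | D. dominating_set G D}"

definition delete_edges :: "'a ugraph \<Rightarrow> 'a set set \<Rightarrow> 'a ugraph" where
  "delete_edges G F = \<lparr>verts = verts G, edges = edges G - F\<rparr>"

text \<open>
  For a finite simple graph with at least one edge the minimum is over a finite nonempty set,
  since deleting all edges raises the domination number to the number of vertices.
  For a graph without edges the value is unspecified.
\<close>

definition bondage_number :: "'a ugraph \<Rightarrow> nat" where
  "bondage_number G =
     Min {card F | F. F \<subseteq> edges G \<and> domination_number (delete_edges G F) > domination_number G}"

end

theory Submission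
  imports Defs "HOL-Library.Code_Binary_Nat"
begin

text \<open>
  The counterexample is a cubic bipartite graph on 18 vertices. Deleting the five edges at two
  adjacent vertices of a cubic graph always increases the domination number, so the bondage number
  is at most 5. A dominating set \<open>D\<close> stops dominating after the deletion of \<open>F\<close> exactly when \<open>F\<close>
  contains all edges between some vertex outside \<open>D\<close> and \<open>D\<close>. Hence it suffices to exhibit a
  family of dominating sets of size 6 such that no four edges destroy all of them at once. Branching
  over the ways to destroy the sets one after the other verifies this; in the same way, branching
  over the vertices of closed neighbourhoods shows that no five vertices dominate.
\<close>

section \<open>Domination and bondage numbers\<close>

lemma finite_dominating_sets:
  assumes "finite (verts G)"
  shows "finite {D. dominating_set G D}"
  by (rule finite_subset[OF _ finite_Pow_iff[THEN iffD2, OF assms]]) (auto simp: dominating_set_def)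

lemma domination_number_le_card:
  assumes "finite (verts G)" "dominating_set G D"
  shows "domination_number G \<le> card D"
  unfolding domination_number_def
  using assms finite_dominating_sets[OF assms(1)]
  by (auto simp: setcompr_eq_image intro!: Min_le)

lemma obtain_minimum_dominating_set:
  assumes "finite (verts G)"
  obtains D where "dominating_set G D" "card D = domination_number G"
proof -
  have "dominating_set G (verts G)"
    by (simp add: dominating_set_def)
  then have "domination_number G \<in> {card D | D. dominating_set G D}"
    unfolding domination_number_def
    using finite_dominating_sets[OF assms] by (intro Min_in) (auto simp: setcompr_eq_image)
  then show thesis
    using that by auto
qed

lemma bondage_number_le_card:
  assumes "finite (edges G)" "F \<subseteq> edges G"
    and "domination_number (delete_edges G F) > domination_number G"
  shows "bondage_number G \<le> card F"
proof -
  have "finite {F. F \<subseteq> edges G \<and> domination_number (delete_edges G F) > domination_number G}"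
    by (rule finite_subset[OF _ finite_Pow_iff[THEN iffD2, OF assms(1)]]) auto
  then show ?thesis
    unfolding bondage_number_def using assms(2,3)
    by (auto simp: setcompr_eq_image intro!: Min_le)
qed

text \<open>The witness \<open>F\<close> makes the set under \<open>Min\<close> nonempty, so that
  the minimum is attained.\<close>

lemma le_bondage_number:
  assumes "finite (edges G)" "F \<subseteq> edges G"
    and "domination_number (delete_edges G F) > domination_number G"
    and least: "\<And>F. F \<subseteq> edges G \<Longrightarrow> card F < k \<Longrightarrow>
           domination_number (delete_edges G F) \<le> domination_number G"
  shows "k \<le> bondage_number G"
proof -
  have fin: "finite {F. F \<subseteq> edges G \<and> domination_number (delete_edges G F) > domination_number G}"
    by (rule finite_subset[OF _ finite_Pow_iff[THEN iffD2, OF assms(1)]]) auto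
  have "k \<le> card F"
    if "F \<subseteq> edges G" "domination_number (delete_edges G F) > domination_number G" for F
    using least[OF that(1)] that(2) by (meson not_le)
  then show ?thesis
    unfolding bondage_number_def using assms(2,3) fin
    by (subst Min_ge_iff) (auto simp: setcompr_eq_image)
qed

text \<open>Once \<open>u\<close> and \<open>v\<close> are isolated, every dominating set contains both of them, and then
  \<open>u\<close> is superfluous in the original graph.\<close>

lemma domination_number_delete_incident_edges:
  assumes "simple_graph G" and uv: "{u, v} \<in> edges G"
  shows "domination_number G < domination_number (delete_edges G {e \<in> edges G. u \<in> e \<or> v \<in> e})"
    (is "_ < domination_number ?H")
proof -
  have fin: "finite (verts G)" and sub: "u \<in> verts G" "v \<in> verts G" and "card {u, v} = 2"
    using assms unfolding simple_graph_def by auto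
  then have neq: "u \<noteq> v" by auto
  obtain D where D: "dominating_set ?H D" "card D = domination_number ?H"
    using obtain_minimum_dominating_set[of ?H] fin by (auto simp: delete_edges_def)
  have in_D: "u \<in> D" "v \<in> D"
    using D(1) sub by (auto simp: dominating_set_def delete_edges_def)
  have "dominating_set G (D - {u})"
    using D(1) in_D uv neq unfolding dominating_set_def delete_edges_def by fastforce
  then have "domination_number G \<le> card (D - {u})"
    by (rule domination_number_le_card[OF fin])
  moreover have "finite D"
    using D(1) fin by (auto simp: dominating_set_def delete_edges_def intro: finite_subset)
  ultimately show ?thesis
    using in_D(1) D(2) by (metis card_Diff1_less le_less_trans)
qed

section \<open>Families of lists hit by a small set\<close>

text \<open>The functions below are evaluated by the simplifier. The lazy connectives get their right
  operand as a function and an argument, because the simplifier normalizes the operands of an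
  ordinary connective again after each evaluation step, including the whole remaining input.\<close>

fun lazy_or :: "bool \<Rightarrow> ('b \<Rightarrow> bool) \<Rightarrow> 'b \<Rightarrow> bool" where
  "lazy_or True P x = True"
| "lazy_or False P x = P x"

fun lazy_and :: "bool \<Rightarrow> ('b \<Rightarrow> bool) \<Rightarrow> 'b \<Rightarrow> bool" where
  "lazy_and True P x = P x"
| "lazy_and False P x = False"

lemma lazy_or_iff [simp]: "lazy_or b P x \<longleftrightarrow> b \<or> P x"
  by (cases b) simp_all

lemma lazy_and_iff [simp]: "lazy_and b P x \<longleftrightarrow> b \<and> P x"
  by (cases b) simp_all

primrec elem :: "'a list \<Rightarrow> 'a \<Rightarrow> bool" where
  "elem [] x = False"
| "elem (y # ys) x = lazy_or (x = y) (elem ys) x"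

primrec sublist_of :: "'a list \<Rightarrow> 'a list \<Rightarrow> bool" where
  "sublist_of [] F = True"
| "sublist_of (x # C) F = lazy_and (elem F x) (sublist_of C) F"

primrec some_sublist_of :: "'a list list \<Rightarrow> 'a list \<Rightarrow> bool" where
  "some_sublist_of [] F = False"
| "some_sublist_of (C # Cs) F = lazy_or (sublist_of C F) (some_sublist_of Cs) F"

lemma elem_iff [simp]: "elem xs x \<longleftrightarrow> x \<in> set xs"
  by (induction xs) auto

lemma sublist_of_iff [simp]: "sublist_of C F \<longleftrightarrow> set C \<subseteq> set F"
  by (induction C) auto

lemma some_sublist_of_iff [simp]: "some_sublist_of Cs F \<longleftrightarrow> (\<exists>C \<in> set Cs. set C \<subseteq> set F)"
  by (induction Cs) auto

fun extend :: "nat \<Rightarrow> 'a list \<Rightarrow> 'a list \<Rightarrow> (nat \<times> 'a list) option" where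
  "extend k F [] = Some (k, F)"
| "extend k F (x # C) =
     (if elem F x then extend k F C
      else if k = 0 then None else extend (k - 1) (x # F) C)"

text \<open>\<open>None\<close> marks a branch that has exhausted its budget and therefore counts as
  refuted.\<close>

fun holds_if_some :: "(nat \<Rightarrow> 'a list \<Rightarrow> bool) \<Rightarrow> (nat \<times> 'a list) option \<Rightarrow> bool" where
  "holds_if_some P None = True"
| "holds_if_some P (Some (k, F)) = P k F"

primrec all_extensions ::
    "'a list list \<Rightarrow> (nat \<Rightarrow> 'a list \<Rightarrow> bool) \<Rightarrow> nat \<Rightarrow> 'a list \<Rightarrow> bool" where
  "all_extensions [] P k F = True"
| "all_extensions (C # Cs) P k F =
     lazy_and (holds_if_some P (extend k F C)) (all_extensions Cs P k) F"

fun branch ::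
    "bool \<Rightarrow> (nat \<Rightarrow> 'a list \<Rightarrow> bool) \<Rightarrow> nat \<Rightarrow> 'a list \<Rightarrow> 'a list list \<Rightarrow> bool" where
  "branch True P k F Cs = P k F"
| "branch False P k F Cs = all_extensions Cs P k F"

text \<open>Tests by branching that no set consisting of \<open>F\<close> and at most \<open>k\<close> further elements contains
  a member of every collection in \<open>Css\<close>.\<close>

primrec avoidable :: "'a list list list \<Rightarrow> nat \<Rightarrow> 'a list \<Rightarrow> bool" where
  "avoidable [] k F = False"
| "avoidable (Cs # Css) k F = branch (some_sublist_of Cs F) (avoidable Css) k F Cs"

lemma all_extensions_iff:
  "all_extensions Cs P k F \<longleftrightarrow> (\<forall>C \<in> set Cs. holds_if_some P (extend k F C))"
  by (induction Cs) auto

text \<open>The budget bounds the number of elements of \<open>X\<close> still missing from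
  \<open>F\<close>. Each new element of \<open>C\<close> lies in \<open>X\<close> and lowers this
  number, so the budget cannot run out.\<close>

lemma extend_within:
  assumes "finite X" "set F \<subseteq> X" "set C \<subseteq> X" "card (X - set F) \<le> k"
  shows "\<exists>k' F'. extend k F C = Some (k', F') \<and> set F' \<subseteq> X \<and> card (X - set F') \<le> k'"
  using assms
proof (induction C arbitrary: k F)
  case (Cons x C)
  show ?case
  proof (cases "x \<in> set F")
    case False
    then have "card (X - set (x # F)) < card (X - set F)"
      using Cons.prems by (intro psubset_card_mono) auto
    then show ?thesis
      using Cons.IH[of "x # F" "k - 1"] Cons.prems False by auto
  qed (use Cons in auto)
qed auto

text \<open>If every collection had a member inside \<open>X\<close>, the branches choosing these
  members would stay inside \<open>X\<close> and within budget, and would reach the empty list,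
  where the test fails.\<close>

lemma avoidable_sound:
  assumes "avoidable Css k F" "finite X" "set F \<subseteq> X" "card (X - set F) \<le> k"
  shows "\<exists>Cs \<in> set Css. \<forall>C \<in> set Cs. \<not> set C \<subseteq> X"
  using assms
proof (induction Css arbitrary: k F)
  case (Cons Cs Css)
  show ?case
  proof (cases "\<exists>C \<in> set Cs. set C \<subseteq> X")
    case True
    then obtain C where C: "C \<in> set Cs" "set C \<subseteq> X" by blast
    obtain k' F' where *: "extend k F C = Some (k', F')" "set F' \<subseteq> X" "card (X - set F') \<le> k'"
      using extend_within[OF Cons.prems(2,3) C(2) Cons.prems(4)] by blast
    show ?thesis
    proof (cases "some_sublist_of Cs F")
      case True
      then have "avoidable Css k F"
        using Cons.prems(1) by (simp del: some_sublist_of_iff)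
      from Cons.IH[OF this Cons.prems(2-4)] show ?thesis by auto
    next
      case False
      then have "all_extensions Cs (avoidable Css) k F"
        using Cons.prems(1) by (simp del: some_sublist_of_iff)
      then have "holds_if_some (avoidable Css) (extend k F C)"
        using C(1) by (simp add: all_extensions_iff)
      then have "avoidable Css k' F'"
        using *(1) by simp
      from Cons.IH[OF this Cons.prems(2) *(2,3)] show ?thesis by auto
    qed
  qed auto
qed simp

section \<open>The counterexample\<close>

text \<open>For \<open>i < 3\<close> and indices modulo 3, write \<open>a\<^sub>i\<close>, \<open>b\<^sub>i\<close>, \<open>c\<^sub>i\<close> for \<open>i\<close>, \<open>3 + i\<close>, \<open>6 + i\<close> and
  \<open>a'\<^sub>i\<close>, \<open>b'\<^sub>i\<close>, \<open>c'\<^sub>i\<close> for \<open>9 + i\<close>, \<open>12 + i\<close>, \<open>15 + i\<close>. Then \<open>a\<^sub>i\<close> is adjacent to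
  \<open>a'\<^sub>i\<close>, \<open>a'\<^sub>i\<^sub>+\<^sub>2\<close>, \<open>c'\<^sub>i\<close>, while \<open>b\<^sub>i\<close> is adjacent to \<open>b'\<^sub>i\<^sub>+\<^sub>1\<close>, \<open>b'\<^sub>i\<^sub>+\<^sub>2\<close>, \<open>c'\<^sub>i\<close> and
  \<open>c\<^sub>i\<close> to \<open>a'\<^sub>i\<close>, \<open>b'\<^sub>i\<close>, \<open>c'\<^sub>i\<close>.\<close>

definition adj_list :: "nat \<Rightarrow> nat list" where
  "adj_list v =
     [[9, 11, 15], [9, 10, 16], [10, 11, 17], [13, 14, 15], [12, 14, 16], [12, 13, 17],
      [9, 12, 15], [10, 13, 16], [11, 14, 17],
      [0, 1, 6], [1, 2, 7], [0, 2, 8], [4, 5, 6], [3, 5, 7], [3, 4, 8],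
      [0, 3, 6], [1, 4, 7], [2, 5, 8]] ! v"

definition counterexample :: "nat ugraph" where
  "counterexample =
     \<lparr>verts = {0..<18}, edges = {{v, u} |v u. v < 18 \<and> u \<in> set (adj_list v)}\<rparr>"

text \<open>An edge is represented by the increasing pair of its end vertices.\<close>

definition star_in :: "nat list \<Rightarrow> nat \<Rightarrow> (nat \<times> nat) list" where
  "star_in D v =
     map (\<lambda>u. if v < u then (v, u) else (u, v)) (filter (\<lambda>u. u \<in> set D) (adj_list v))"

definition stars_in :: "nat list \<Rightarrow> (nat \<times> nat) list list" where
  "stars_in D = map (star_in D) (filter (\<lambda>v. v \<notin> set D) [0..<18])"

text \<open>Found by computer search, and ordered so that the branching test below stays small: each set
  is chosen to have few vertices with only one neighbour in it.\<close>

definition dominating_family :: "nat list list" where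
  "dominating_family =
  [[3,4,5,9,10,11], [0,1,2,12,13,14], [1,4,11,13,15,17], [0,5,6,10,14,16],
   [0,3,4,6,10,17], [0,4,6,8,10,13], [1,3,5,6,11,16], [2,5,9,14,15,16],
   [0,1,4,7,15,17], [1,2,12,13,14,15], [1,3,7,8,11,12], [1,5,8,15,16,17],
   [2,3,9,12,16,17], [1,8,10,12,13,15], [2,3,8,9,12,16], [2,3,9,11,12,16],
   [0,2,3,6,16,17], [1,5,6,7,11,14], [0,1,12,13,14,17], [2,7,9,12,14,15],
   [0,1,2,6,13,14], [5,8,9,10,15,16], [0,4,5,10,11,15], [0,1,2,8,12,13],
   [0,3,7,8,10,12], [1,4,6,8,11,13], [2,5,6,7,9,14], [4,5,9,10,11,15],
   [0,3,10,12,16,17], [0,4,9,10,13,17], [1,4,5,7,11,15], [0,2,12,13,14,16],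
   [1,3,7,11,12,17], [1,2,3,7,11,12], [0,1,2,7,12,14], [2,6,9,13,14,16],
   [6,8,10,11,13,16], [3,5,6,10,11,16], [3,5,9,10,11,16], [2,3,5,9,16,17],
   [3,4,9,10,11,17], [2,4,8,9,13,15], [1,2,4,8,13,15], [0,4,5,8,10,15],
   [0,7,10,12,14,17], [1,5,10,11,14,15], [0,3,4,7,9,17], [3,4,5,6,10,11],
   [1,8,11,12,13,15], [1,4,5,8,10,15], [3,4,5,7,9,11], [3,4,5,8,9,10],
   [2,3,5,6,11,16], [0,2,5,7,9,14], [2,7,8,9,12,15], [0,7,9,12,14,17],
   [0,4,10,13,15,17], [1,5,11,14,15,16], [2,6,11,13,14,16]]"

section \<open>Structure of the graph\<close>

lemma adj_list_props:
  assumes "v < 18"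
  shows "distinct (adj_list v)" "length (adj_list v) = 3"
    and "u \<in> set (adj_list v) \<Longrightarrow> u < 18 \<and> v \<in> set (adj_list u) \<and> (u < 9 \<longleftrightarrow> \<not> v < 9)"
proof -
  have "\<forall>v \<in> set [0..<18]. distinct (adj_list v) \<and> length (adj_list v) = 3 \<and>
      (\<forall>u \<in> set (adj_list v). u < 18 \<and> v \<in> set (adj_list u) \<and> (u < 9 \<longleftrightarrow> \<not> v < 9))"
    by code_simp
  then show "distinct (adj_list v)" "length (adj_list v) = 3"
    and "u \<in> set (adj_list v) \<Longrightarrow> u < 18 \<and> v \<in> set (adj_list u) \<and> (u < 9 \<longleftrightarrow> \<not> v < 9)"
    using assms unfolding set_upt atLeastLessThan_iff Ball_def by blast+
qed

lemma verts_counterexample [simp]: "verts counterexample = {0..<18}"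
  by (simp add: counterexample_def)

lemma edge_iff: "{v, u} \<in> edges counterexample \<longleftrightarrow> v < 18 \<and> u \<in> set (adj_list v)"
  using adj_list_props(3) by (auto simp: counterexample_def doubleton_eq_iff)

lemma edgeE:
  assumes "e \<in> edges counterexample"
  obtains v u where "e = {v, u}" "v < 9" "9 \<le> u" "u < 18" "u \<in> set (adj_list v)"
proof -
  obtain v u where e: "e = {v, u}" "v < 18" "u \<in> set (adj_list v)"
    using assms by (auto simp: counterexample_def)
  note p = adj_list_props(3)[OF e(2,3)]
  show thesis
  proof (cases "v < 9")
    case True
    with e p show thesis by (intro that[of v u]) simp_all
  next
    case False
    with e p show thesis by (intro that[of u v]) (simp_all add: insert_commute)
  qed
qed

lemma incident_edge:
  assumes "e \<in> edges counterexample" "v \<in> e"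
  shows "\<exists>u \<in> set (adj_list v). e = {v, u}"
proof -
  obtain a b where "e = {a, b}"
    using assms(1) by (rule edgeE)
  with assms(2) obtain u where e: "e = {v, u}" by auto
  with assms(1) show ?thesis by (auto simp: edge_iff)
qed

lemma simple_counterexample: "simple_graph counterexample"
  by (auto simp: simple_graph_def elim!: edgeE)

lemma finite_edges_counterexample: "finite (edges counterexample)"
  by (rule finite_subset[of _ "Pow {0..<18}"]) (auto elim!: edgeE)

lemma degree_counterexample: "v < 18 \<Longrightarrow> degree counterexample v = 3"
  by (simp add: degree_def neighbors_def edge_iff adj_list_props(1,2) distinct_card)

lemma bipartite_counterexample: "bipartite counterexample"
proof -
  have "\<exists>a \<in> {0..<9}. \<exists>b \<in> {9..<18}. e = {a, b}" if "e \<in> edges counterexample" for e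
    using that by (rule edgeE) (metis atLeastLessThan_iff le0)
  then show ?thesis
    unfolding bipartite_def by (intro exI[of _ "{0..<9}"] exI[of _ "{9..<18}"]) auto
qed

lemma successively_rtrancl:
  assumes "successively (\<lambda>x y. (x, y) \<in> R) (x # xs)" "y \<in> set (x # xs)"
  shows "(x, y) \<in> R\<^sup>*"
  using assms
proof (induction xs arbitrary: x)
  case (Cons z zs)
  then show ?case
    by (auto simp: converse_rtrancl_into_rtrancl)
qed simp

lemma connected_counterexample: "connected_graph counterexample"
proof -
  define R where "R = {(x, y). {x, y} \<in> edges counterexample}"
  have "sym (R\<^sup>*)"
    by (intro sym_rtrancl) (auto simp: R_def sym_def insert_commute)
  \<comment> \<open>A Hamiltonian path.\<close>
  let ?path = "[0, 9, 1, 10, 2, 11, 8, 14, 3, 15, 6, 12, 4, 16, 7, 13, 5, 17]"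
  have "successively (\<lambda>x y. x < 18 \<and> y \<in> set (adj_list x)) ?path"
    by code_simp
  then have "successively (\<lambda>x y. (x, y) \<in> R) ?path"
    unfolding R_def mem_Collect_eq prod.case edge_iff .
  moreover have "v \<in> set ?path" if "v < 18" for v :: nat
  proof -
    have "\<forall>v \<in> set [0..<18]. v \<in> set ?path"
      by code_simp
    then show ?thesis
      using that unfolding set_upt by simp
  qed
  ultimately have "(0, v) \<in> R\<^sup>*" if "v < 18" for v :: nat
    using successively_rtrancl[of R 0 "tl ?path" v] that unfolding list.sel by blast
  with \<open>sym (R\<^sup>*)\<close> have "(u, v) \<in> R\<^sup>*" if "u < 18" "v < 18" for u v
    using that by (meson rtrancl_trans symD)
  then show ?thesis
    by (auto simp: connected_graph_def R_def)
qed

section \<open>Domination and bondage numbers of the graph\<close>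

lemma avoidable_closed_neighborhoods:
  "avoidable (map (\<lambda>v. map (\<lambda>u. [u]) (v # adj_list v)) [0..<18]) 5 []"
  by code_simp

lemma avoidable_stars:
  "avoidable (map stars_in dominating_family) 4 []"
  by code_simp

text \<open>A dominating set meets every closed neighbourhood. With each neighbourhood encoded as
  the collection of its singletons, the branching test excludes this for at most five
  vertices.\<close>

lemma domination_number_counterexample_ge: "6 \<le> domination_number counterexample"
proof -
  obtain D where D: "dominating_set counterexample D"
      "card D = domination_number counterexample"
    using obtain_minimum_dominating_set[of counterexample] by auto
  have "finite D"
    using D(1) by (auto simp: dominating_set_def intro: finite_subset)
  have "\<not> card D \<le> 5"
  proof
    assume "card D \<le> 5"
    then obtain v where "v < 18" "v \<notin> D" "\<forall>u \<in> set (adj_list v). u \<notin> D"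
      using avoidable_sound[OF avoidable_closed_neighborhoods \<open>finite D\<close>]
      unfolding set_map set_upt by auto
    then show False
      using D(1) by (auto simp: dominating_set_def edge_iff)
  qed
  then show ?thesis using D(2) by simp
qed

lemma domination_number_delete_le:
  assumes "F \<subseteq> edges counterexample" "card F \<le> 4"
  shows "domination_number (delete_edges counterexample F) \<le> 6"
proof -
  \<comment> \<open>The edges of \<open>F\<close> as increasing pairs, matching
    \<open>star_in\<close>; each edge yields at most one pair, so the budget 4 suffices.\<close>
  define X where "X = {(a, b). a < b \<and> {a, b} \<in> F}"
  have fin: "finite F"
    using assms(1) finite_edges_counterexample by (rule finite_subset)
  have inj: "inj_on (\<lambda>(a, b). {a, b}) X"
    by (auto simp: inj_on_def X_def doubleton_eq_iff)
  have im: "(\<lambda>(a, b). {a, b}) ` X \<subseteq> F"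
    by (auto simp: X_def)
  have "finite X" "card X \<le> 4"
    using inj_on_finite[OF inj im fin] card_inj_on_le[OF inj im fin] assms(2) by auto
  then obtain D where D: "D \<in> set dominating_family"
      "\<And>v. v < 18 \<Longrightarrow> v \<notin> set D \<Longrightarrow> \<not> set (star_in D v) \<subseteq> X"
    using avoidable_sound[OF avoidable_stars, of X] by (auto simp: stars_in_def simp del: upt_rec_numeral)
  have "list_all (\<lambda>D. length D = 6 \<and> list_all (\<lambda>v. v < 18) D) dominating_family"
    by code_simp
  with D(1) have len: "length D = 6" and sub: "set D \<subseteq> {0..<18}"
    by (auto simp: list_all_iff)
  have "\<exists>u \<in> set D. {v, u} \<in> edges counterexample - F" if v: "v < 18" "v \<notin> set D" for v
  proof -
    obtain u where u: "u \<in> set D" "u \<in> set (adj_list v)"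
        "(if v < u then (v, u) else (u, v)) \<notin> X"
      using D(2)[OF v] unfolding star_in_def set_map set_filter by blast
    then have "{v, u} \<notin> F"
      using v by (auto simp: X_def insert_commute split: if_splits)
    then show ?thesis using u v by (auto simp: edge_iff)
  qed
  then have "dominating_set (delete_edges counterexample F) (set D)"
    using sub by (auto simp: dominating_set_def delete_edges_def)
  then have "domination_number (delete_edges counterexample F) \<le> card (set D)"
    by (intro domination_number_le_card) (simp_all add: delete_edges_def)
  also have "\<dots> \<le> 6" using card_length[of D] len by simp
  finally show ?thesis .
qed

lemma domination_number_counterexample: "domination_number counterexample = 6"
proof -
  \<comment> \<open>Deleting nothing turns the bound for damaged graphs into the upper bound for the
    graph itself.\<close>
  have "delete_edges counterexample {} = counterexample"
    unfolding delete_edges_def counterexample_def by simp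
  with domination_number_delete_le[of "{}"] domination_number_counterexample_ge
  show ?thesis by simp
qed

lemma bondage_number_counterexample: "bondage_number counterexample = 5"
proof -
  \<comment> \<open>Two adjacent vertices of degree 3 meet 3 + 3 - 1 = 5 edges.\<close>
  let ?F = "{e \<in> edges counterexample. 0 \<in> e \<or> 9 \<in> e}"
  have edge: "{0, 9} \<in> edges counterexample"
    by (simp add: edge_iff adj_list_def)
  have raises: "domination_number counterexample < domination_number (delete_edges counterexample ?F)"
    by (rule domination_number_delete_incident_edges[OF simple_counterexample edge])
  have "?F \<subseteq> set [{0, 9}, {0, 11}, {0, 15}, {9, 1}, {9, 6}]"
  proof
    fix e assume "e \<in> ?F"
    then have "(\<exists>u \<in> set (adj_list 0). e = {0, u}) \<or> (\<exists>u \<in> set (adj_list 9). e = {9, u})"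
      using incident_edge by blast
    then show "e \<in> set [{0, 9}, {0, 11}, {0, 15}, {9, 1}, {9, 6}]"
      by (auto simp: adj_list_def)
  qed
  then have "card ?F \<le> card (set [{0, 9}, {0, 11}, {0, 15}, {9, 1}, {9, 6 :: nat}])"
    by (rule card_mono[OF finite_set])
  also have "\<dots> \<le> 5"
    using card_length[of "[{0, 9}, {0, 11}, {0, 15}, {9, 1}, {9, 6 :: nat}]"] by simp
  finally have "card ?F \<le> 5" .
  moreover have "bondage_number counterexample \<le> card ?F"
    by (rule bondage_number_le_card[OF finite_edges_counterexample _ raises]) auto
  moreover have "5 \<le> bondage_number counterexample"
  proof (rule le_bondage_number[OF finite_edges_counterexample _ raises])
    fix F assume "F \<subseteq> edges counterexample" "card F < 5"
    then show "domination_number (delete_edges counterexample F) \<le> domination_number counterexample"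
      using domination_number_delete_le[of F] by (simp add: domination_number_counterexample)
  qed auto
  ultimately show ?thesis by simp
qed

theorem theorem1p2:
  "(\<exists>G :: nat ugraph.
      simple_graph G \<and> connected_graph G \<and> cubic G \<and> bipartite G \<and>
      domination_number G = 6 \<and> bondage_number G = 5 \<and>
      real (bondage_number G) > 9 / 2 \<and> (9 / 2 :: real) = 3 / 2 * real (max_degree G)) \<and>
   \<not> (\<forall>H :: nat ugraph. simple_graph H \<and> edges H \<noteq> {} \<longrightarrow>
        real (bondage_number H) \<le> 3 / 2 * real (max_degree H))"
proof -
  have "degree counterexample ` verts counterexample = (\<lambda>v. 3) ` {0..<18 :: nat}"
    by (intro image_cong) (simp_all add: degree_counterexample)
  then have "degree counterexample ` verts counterexample = {3}"
    by (simp add: image_constant_conv)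
  then have max: "max_degree counterexample = 3"
    by (simp add: max_degree_def)
  have cubic: "cubic counterexample"
    by (simp add: cubic_def degree_counterexample)
  have nonempty: "edges counterexample \<noteq> {}"
    using edge_iff[of 0 9] by (auto simp: adj_list_def)
  show ?thesis
  proof
    show "\<exists>G :: nat ugraph.
      simple_graph G \<and> connected_graph G \<and> cubic G \<and> bipartite G \<and>
      domination_number G = 6 \<and> bondage_number G = 5 \<and>
      real (bondage_number G) > 9 / 2 \<and> (9 / 2 :: real) = 3 / 2 * real (max_degree G)"
      by (rule exI[of _ counterexample])
        (simp add: simple_counterexample connected_counterexample cubic bipartite_counterexample
          domination_number_counterexample bondage_number_counterexample max)
    have "\<not> real (bondage_number counterexample) \<le> 3 / 2 * real (max_degree counterexample)"
      by (simp add: bondage_number_counterexample max)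
    then show "\<not> (\<forall>H :: nat ugraph. simple_graph H \<and> edges H \<noteq> {} \<longrightarrow>
        real (bondage_number H) \<le> 3 / 2 * real (max_degree H))"
      using simple_counterexample nonempty by blast
  qed
qed

end
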